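(* Let $U\subset\mathbb{R}^2_+$ be a smooth bounded domain of the upper half plane, and let $\Omega\subset\mathbb{H}^1$ be the open set $\Omega=w^{-1}(U)=\{(z,t)\in\mathbb{H}^1 : w(z,t)\in U\}$. Then $\Omega$ is diffeomorphic to $U\times S^1$.
   Context: The Heisenberg group $\mathbb{H}^1$ has underlying manifold $\mathbb{C}\times\mathbb{R}=\mathbb{R}^3$, with points written $(z,t)=(x,y,t)$, $z=x+iy$. The upper half plane is $\mathbb{R}^2_+=\{(x,y)\in\mathbb{R}^2 : y>0\}$, viewed inside $\mathbb{R}^2\cong\mathbb{C}$. The map $w:\mathbb{H}^1\to\mathbb{C}\cong\mathbb{R}^2$ is $w(z,t)=t+i|z|^2$, i.e. $(z,t)\mapsto(t,|z|^2)$. $S^1$ is the unit circle in $\mathbb{C}$. *)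

theory Defs
  imports "HOL-Analysis.Analysis"
begin

fun higher_differentiable_on ::
    "'a::real_normed_vector set \<Rightarrow> ('a \<Rightarrow> 'b::real_normed_vector) \<Rightarrow> nat \<Rightarrow> bool" where
  "higher_differentiable_on S f 0 \<longleftrightarrow> continuous_on S f"
| "higher_differentiable_on S f (Suc n) \<longleftrightarrow>
     (\<forall>x\<in>S. f differentiable (at x)) \<and>
     (\<forall>v. higher_differentiable_on S (\<lambda>x. frechet_derivative f (at x) v) n)"

text \<open>Infinite differentiability; only meant for open \<open>S\<close>, as derivatives are taken
  in the ambient space.\<close>

definition smooth_on :: "'a::real_normed_vector set \<Rightarrow> ('a \<Rightarrow> 'b::real_normed_vector) \<Rightarrow> bool" where
  "smooth_on S f \<longleftrightarrow> (\<forall>n. higher_differentiable_on S f n)"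

text \<open>Smoothness on an arbitrary subset of a Euclidean space is the existence of local smooth
  extensions. On an embedded submanifold this agrees with smoothness in charts.\<close>

definition smooth_map_on ::
    "'a::euclidean_space set \<Rightarrow> ('a \<Rightarrow> 'b::euclidean_space) \<Rightarrow> bool" where
  "smooth_map_on A f \<longleftrightarrow>
     (\<forall>x\<in>A. \<exists>V g. open V \<and> x \<in> V \<and> smooth_on V g \<and> (\<forall>y\<in>A \<inter> V. f y = g y))"

definition diffeomorphic :: "'a::euclidean_space set \<Rightarrow> 'b::euclidean_space set \<Rightarrow> bool"
    (infixr "diffeomorphic" 60) where
  "A diffeomorphic B \<longleftrightarrow>
     (\<exists>f g. smooth_map_on A f \<and> smooth_map_on B g \<and>
            f ` A = B \<and> g ` B = A \<and>
            (\<forall>x\<in>A. g (f x) = x) \<and> (\<forall>y\<in>B. f (g y) = y))"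

text \<open>Near each boundary point, \<open>U\<close> is the sublevel set of a smooth function without critical
  points; hence the boundary is locally the zero set and \<open>U\<close> lies on one side of it.\<close>

definition smooth_boundary :: "'a::euclidean_space set \<Rightarrow> bool" where
  "smooth_boundary U \<longleftrightarrow>
     (\<forall>p\<in>frontier U. \<exists>V (\<rho> :: 'a \<Rightarrow> real). open V \<and> p \<in> V \<and> smooth_on V \<rho> \<and>
        (\<forall>x\<in>V. \<exists>v. frechet_derivative \<rho> (at x) v \<noteq> 0) \<and>
        U \<inter> V = {x \<in> V. \<rho> x < 0})"

definition smooth_bounded_domain :: "'a::euclidean_space set \<Rightarrow> bool" where
  "smooth_bounded_domain U \<longleftrightarrow>
     open U \<and> connected U \<and> U \<noteq> {} \<and> bounded U \<and> smooth_boundary U"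

text \<open>The plane is identified with \<open>complex\<close> via \<open>(x, y) = x + \<i> y\<close>.\<close>

definition upper_half_plane :: "complex set" where
  "upper_half_plane = {u. Im u > 0}"

text \<open>The underlying manifold of the Heisenberg group, with points \<open>(z, t)\<close>; the group law is
  not needed.\<close>

type_synonym heisenberg = "complex \<times> real"

definition w :: "heisenberg \<Rightarrow> complex" where
  "w = (\<lambda>(z, t). complex_of_real t + \<i> * complex_of_real ((cmod z)\<^sup>2))"

end

theory Submission
  imports Defs
begin

text \<open>On the open set \<open>z \<noteq> 0\<close> the map \<open>(z, t) \<mapsto> (w (z, t), z / |z|)\<close> is smooth, with smooth
  inverse \<open>(u, s) \<mapsto> (\<surd>(Im u) s, Re u)\<close> on \<open>Im u > 0\<close>. As \<open>U\<close> lies in the upper half plane,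
  \<open>z \<noteq> 0\<close> throughout \<open>\<Omega>\<close>. The only non-polynomial ingredients are real powers of positive
  smooth functions.\<close>

section \<open>Iterated derivatives on open sets\<close>

lemma higher_differentiable_on_cong:
  assumes "open S" "\<And>x. x \<in> S \<Longrightarrow> f x = g x"
  shows "higher_differentiable_on S f n \<longleftrightarrow> higher_differentiable_on S g n"
  using assms(2)
proof (induction n arbitrary: f g)
  case 0
  then show ?case by (simp cong: continuous_on_cong)
next
  case (Suc n)
  \<comment> \<open>Openness of \<open>S\<close> enters here: the ambient derivative at a point of
    \<open>S\<close> sees only values near that point.\<close>
  have D: "(f has_derivative D) (at x) \<longleftrightarrow> (g has_derivative D) (at x)" if "x \<in> S" for x D
    using has_derivative_transform_within_open[OF _ assms(1) that] Suc.prems by metis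
  then have "frechet_derivative f (at x) = frechet_derivative g (at x)" if "x \<in> S" for x
    using that unfolding frechet_derivative_def by simp
  then have "higher_differentiable_on S (\<lambda>x. frechet_derivative f (at x) v) n \<longleftrightarrow>
      higher_differentiable_on S (\<lambda>x. frechet_derivative g (at x) v) n" for v
    by (intro Suc.IH) auto
  with D show ?case by (auto simp: differentiable_def)
qed

text \<open>Lets each closure proof below use an explicit derivative from a differentiation rule
  instead of the choice term \<open>frechet_derivative\<close>; values of \<open>D\<close> off
  \<open>S\<close> are irrelevant by congruence.\<close>

lemma higher_differentiable_on_SucI:
  assumes "open S" "\<And>x. x \<in> S \<Longrightarrow> (f has_derivative D x) (at x)"
    "\<And>v. higher_differentiable_on S (\<lambda>x. D x v) n"
  shows "higher_differentiable_on S f (Suc n)"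
proof -
  have "frechet_derivative f (at x) v = D x v" if "x \<in> S" for x v
    using frechet_derivative_at[OF assms(2)[OF that]] by simp
  then have "higher_differentiable_on S (\<lambda>x. frechet_derivative f (at x) v) n" for v
    by (intro iffD2[OF higher_differentiable_on_cong[OF assms(1)] assms(3)])
  with assms(2) show ?thesis by (auto simp: differentiable_def)
qed

lemma higher_differentiable_on_SucE:
  assumes "higher_differentiable_on S f (Suc n)"
  obtains D where "\<And>x. x \<in> S \<Longrightarrow> (f has_derivative D x) (at x)"
    "\<And>v. higher_differentiable_on S (\<lambda>x. D x v) n"
proof
  show "(f has_derivative frechet_derivative f (at x)) (at x)" if "x \<in> S" for x
    using assms that by (simp flip: frechet_derivative_works)
  show "higher_differentiable_on S (\<lambda>x. frechet_derivative f (at x) v) n" for v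
    using assms by simp
qed

text \<open>Needed because the derivative of a product or a power still contains undifferentiated
  factors, which must be available at the lower order.\<close>

lemma higher_differentiable_on_Suc_imp:
  "higher_differentiable_on S f (Suc n) \<Longrightarrow> higher_differentiable_on S f n"
proof (induction n arbitrary: f)
  case 0
  then show ?case
    by (auto intro!: continuous_at_imp_continuous_on differentiable_imp_continuous_within)
next
  case (Suc n)
  have "higher_differentiable_on S (\<lambda>x. frechet_derivative f (at x) v) n" for v
    using Suc.prems by (intro Suc.IH) simp
  with Suc.prems show ?case by simp
qed

section \<open>Closure properties of n-fold differentiability\<close>

lemma higher_differentiable_on_const:
  assumes "open S"
  shows "higher_differentiable_on S (\<lambda>x. c) n"
proof (induction n arbitrary: c)
  case (Suc n)
  show ?case by (rule higher_differentiable_on_SucI[OF assms has_derivative_const Suc])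
qed simp

lemma higher_differentiable_on_bounded_linear:
  assumes "open S" "bounded_linear L" "higher_differentiable_on S f n"
  shows "higher_differentiable_on S (\<lambda>x. L (f x)) n"
  using assms(3)
proof (induction n arbitrary: f)
  case 0
  then show ?case
    using bounded_linear.continuous_on[OF assms(2)] by simp
next
  case (Suc n)
  obtain D where D: "\<And>x. x \<in> S \<Longrightarrow> (f has_derivative D x) (at x)"
    "\<And>v. higher_differentiable_on S (\<lambda>x. D x v) n"
    using higher_differentiable_on_SucE[OF Suc.prems] by blast
  show ?case
    by (rule higher_differentiable_on_SucI[OF assms(1)
          bounded_linear.has_derivative[OF assms(2) D(1)] Suc.IH[OF D(2)]])
qed

lemma higher_differentiable_on_id:
  assumes "open S"
  shows "higher_differentiable_on S (\<lambda>x. x) n"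
proof (cases n)
  case (Suc m)
  show ?thesis
    unfolding Suc
    by (rule higher_differentiable_on_SucI[OF assms has_derivative_ident
          higher_differentiable_on_const[OF assms]])
qed simp

lemma higher_differentiable_on_add:
  assumes "open S" "higher_differentiable_on S f n" "higher_differentiable_on S g n"
  shows "higher_differentiable_on S (\<lambda>x. f x + g x) n"
  using assms(2,3)
proof (induction n arbitrary: f g)
  case 0
  then show ?case by (simp add: continuous_on_add)
next
  case (Suc n)
  obtain D where D: "\<And>x. x \<in> S \<Longrightarrow> (f has_derivative D x) (at x)"
    "\<And>v. higher_differentiable_on S (\<lambda>x. D x v) n"
    using higher_differentiable_on_SucE[OF Suc.prems(1)] by blast
  obtain E where E: "\<And>x. x \<in> S \<Longrightarrow> (g has_derivative E x) (at x)"
    "\<And>v. higher_differentiable_on S (\<lambda>x. E x v) n"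
    using higher_differentiable_on_SucE[OF Suc.prems(2)] by blast
  show ?case
    by (rule higher_differentiable_on_SucI[OF assms(1)
          has_derivative_add[OF D(1) E(1)] Suc.IH[OF D(2) E(2)]])
qed

text \<open>Induction by the Leibniz rule: the derivative is a sum of two terms of the same bilinear
  form, hence \<open>f\<close> and \<open>g\<close> vary in the induction. Real products, inner
  products and scaling are all instances.\<close>

lemma higher_differentiable_on_bounded_bilinear:
  assumes "open S" "bounded_bilinear B"
    "higher_differentiable_on S f n" "higher_differentiable_on S g n"
  shows "higher_differentiable_on S (\<lambda>x. B (f x) (g x)) n"
  using assms(3,4)
proof (induction n arbitrary: f g)
  case 0
  then show ?case using bounded_bilinear.continuous_on[OF assms(2)] by simp
next
  case (Suc n)
  obtain D where D: "\<And>x. x \<in> S \<Longrightarrow> (f has_derivative D x) (at x)"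
    "\<And>v. higher_differentiable_on S (\<lambda>x. D x v) n"
    using higher_differentiable_on_SucE[OF Suc.prems(1)] by blast
  obtain E where E: "\<And>x. x \<in> S \<Longrightarrow> (g has_derivative E x) (at x)"
    "\<And>v. higher_differentiable_on S (\<lambda>x. E x v) n"
    using higher_differentiable_on_SucE[OF Suc.prems(2)] by blast
  note fg = Suc.prems[THEN higher_differentiable_on_Suc_imp]
  show ?case
    by (rule higher_differentiable_on_SucI[OF assms(1)
          bounded_bilinear.FDERIV[OF assms(2) D(1) E(1)]
          higher_differentiable_on_add[OF assms(1) Suc.IH[OF fg(1) E(2)] Suc.IH[OF D(2) fg(2)]]])
qed

text \<open>A pair is the sum of its images under the two linear embeddings into the product, so no
  new induction is required.\<close>

lemma higher_differentiable_on_Pair: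
  fixes f :: "'a::real_normed_vector \<Rightarrow> 'b::real_normed_vector"
    and g :: "'a \<Rightarrow> 'c::real_normed_vector"
  assumes "open S" "higher_differentiable_on S f n" "higher_differentiable_on S g n"
  shows "higher_differentiable_on S (\<lambda>x. (f x, g x)) n"
proof -
  have "bounded_linear (\<lambda>y::'b. (y, 0::'c))" "bounded_linear (\<lambda>z::'c. (0::'b, z))"
    by (intro bounded_linear_Pair bounded_linear_ident bounded_linear_zero)+
  from higher_differentiable_on_add[OF assms(1)
      higher_differentiable_on_bounded_linear[OF assms(1) this(1) assms(2)]
      higher_differentiable_on_bounded_linear[OF assms(1) this(2) assms(3)]]
  show ?thesis by simp
qed

text \<open>The exponent varies in the induction because differentiation lowers it by one;
  positivity of \<open>f\<close> keeps every real exponent admissible.\<close>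

lemma higher_differentiable_on_powr:
  fixes f :: "'a::real_normed_vector \<Rightarrow> real"
  assumes "open S" "\<And>x. x \<in> S \<Longrightarrow> f x > 0" "higher_differentiable_on S f n"
  shows "higher_differentiable_on S (\<lambda>x. f x powr a) n"
  using assms(3)
proof (induction n arbitrary: a)
  case 0
  then show ?case
    using assms(2) by (force intro!: continuous_on_powr)
next
  case (Suc n)
  obtain D where D: "\<And>x. x \<in> S \<Longrightarrow> (f has_derivative D x) (at x)"
    "\<And>v. higher_differentiable_on S (\<lambda>x. D x v) n"
    using higher_differentiable_on_SucE[OF Suc.prems] by blast
  show ?case
  proof (rule higher_differentiable_on_SucI[OF assms(1)])
    show "((\<lambda>x. f x powr a) has_derivative (\<lambda>v. a * (f x powr (a - 1) * D x v))) (at x)"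
      if "x \<in> S" for x
      \<comment> \<open>The general rule allows a variable exponent; for a constant one its
        logarithmic term vanishes.\<close>
      using has_derivative_powr[OF D(1)[OF that] has_derivative_const assms(2)[OF that], of a]
        assms(2)[OF that]
      by (simp add: powr_diff field_simps)
    have "higher_differentiable_on S (\<lambda>x. f x powr (a - 1) * D x v) n" for v
      by (rule higher_differentiable_on_bounded_bilinear[OF assms(1) bounded_bilinear_mult
            Suc.IH[OF higher_differentiable_on_Suc_imp[OF Suc.prems]] D(2)])
    then show "higher_differentiable_on S (\<lambda>x. a * (f x powr (a - 1) * D x v)) n" for v
      by (rule higher_differentiable_on_bounded_linear[OF assms(1) bounded_linear_mult_right])
  qed
qed

section \<open>Smoothness of the polar maps\<close>

lemma smooth_map_on_subset_open:
  assumes "open V" "A \<subseteq> V" "smooth_on V f"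
  shows "smooth_map_on A f"
  \<comment> \<open>The one open set \<open>V\<close> serves at every point, with \<open>f\<close>
    as its own extension. This covers sets such as \<open>U \<times> S^1\<close> that are not
    open.\<close>
  using assms unfolding smooth_map_on_def by blast

text \<open>Writing |z|^2 as an inner product makes it visibly bilinear, and 1/|z| is its power with
  exponent -1/2, whose base is positive for z \<noteq> 0.\<close>

lemma smooth_on_polar:
  "smooth_on {p :: complex \<times> real. fst p \<noteq> 0}
    (\<lambda>p. (snd p *\<^sub>R 1 + (fst p \<bullet> fst p) *\<^sub>R \<i>, (fst p \<bullet> fst p) powr (- 1 / 2) *\<^sub>R fst p))"
  (is "smooth_on ?V _")
proof -
  have V: "open ?V"
    by (intro open_Collect_neq continuous_intros)
  note id = higher_differentiable_on_id[OF V]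
  note fst = higher_differentiable_on_bounded_linear[OF V bounded_linear_fst id]
  note snd = higher_differentiable_on_bounded_linear[OF V bounded_linear_snd id]
  note inner = higher_differentiable_on_bounded_bilinear[OF V bounded_bilinear_inner fst fst]
  note scaleR = higher_differentiable_on_bounded_bilinear[OF V bounded_bilinear_scaleR]
  show ?thesis
    unfolding smooth_on_def
    by (intro allI higher_differentiable_on_Pair[OF V] higher_differentiable_on_add[OF V] scaleR
        higher_differentiable_on_powr[OF V] higher_differentiable_on_const[OF V] inner fst snd) simp
qed

text \<open>The formula makes sense for every complex s, so it extends from the circle to an open
  set.\<close>

lemma smooth_on_polar_inverse:
  "smooth_on {q :: complex \<times> complex. Im (fst q) > 0}
    (\<lambda>q. (Im (fst q) powr (1 / 2) *\<^sub>R snd q, Re (fst q)))"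
  (is "smooth_on ?V _")
proof -
  have V: "open ?V"
    by (intro open_Collect_less continuous_intros)
  note id = higher_differentiable_on_id[OF V]
  note fst = higher_differentiable_on_bounded_linear[OF V bounded_linear_fst id]
  note snd = higher_differentiable_on_bounded_linear[OF V bounded_linear_snd id]
  note Re = higher_differentiable_on_bounded_linear[OF V bounded_linear_Re fst]
  note Im = higher_differentiable_on_bounded_linear[OF V bounded_linear_Im fst]
  note scaleR = higher_differentiable_on_bounded_bilinear[OF V bounded_bilinear_scaleR]
  show ?thesis
    unfolding smooth_on_def
    by (intro allI higher_differentiable_on_Pair[OF V] scaleR
        higher_differentiable_on_powr[OF V] Re Im snd) simp
qed

theorem proposition2p8:
  fixes U :: "complex set" and \<Omega> :: "heisenberg set"
  assumes "smooth_bounded_domain U"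
    and "U \<subseteq> upper_half_plane"
    and "\<Omega> = w -` U"
  shows "\<Omega> diffeomorphic (U \<times> sphere (0::complex) 1)"
proof -
  define f :: "heisenberg \<Rightarrow> complex \<times> complex" where
    "f = (\<lambda>p. (snd p *\<^sub>R 1 + (fst p \<bullet> fst p) *\<^sub>R \<i>, (fst p \<bullet> fst p) powr (- 1 / 2) *\<^sub>R fst p))"
  define g :: "complex \<times> complex \<Rightarrow> heisenberg" where
    "g = (\<lambda>q. (Im (fst q) powr (1 / 2) *\<^sub>R snd q, Re (fst q)))"
  have f_eq: "f (z, t) = (w (z, t), z /\<^sub>R cmod z)" for z t
    by (simp add: f_def w_def dot_square_norm powr_minus powr_half_sqrt scaleR_conv_of_real)
  have g_eq: "g (u, s) = (sqrt (Im u) *\<^sub>R s, Re u)" if "u \<in> U" for u s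
    using that assms(2) by (auto simp: g_def powr_half_sqrt upper_half_plane_def)
  \<comment> \<open>Disabling \<open>of_real_power\<close> keeps |z|^2 as one embedded real number,
    whose real and imaginary parts are immediate.\<close>
  have w_parts: "Re (w (z, t)) = t" "Im (w (z, t)) = (cmod z)\<^sup>2" for z t
    by (simp_all add: w_def del: of_real_power)
  have Im_pos: "Im u > 0" if "u \<in> U" for u
    using that assms(2) by (auto simp: upper_half_plane_def)
  have nz: "z \<noteq> 0" if "(z, t) \<in> \<Omega>" for z t
    using that Im_pos[of "w (z, t)"] assms(3) w_parts by auto
  have "smooth_map_on \<Omega> f"
    unfolding f_def using nz
    by (intro smooth_map_on_subset_open[OF _ _ smooth_on_polar] open_Collect_neq continuous_intros)
      auto
  moreover have "smooth_map_on (U \<times> sphere 0 1) g"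
    unfolding g_def using Im_pos
    by (intro smooth_map_on_subset_open[OF _ _ smooth_on_polar_inverse] open_Collect_less
        continuous_intros) auto
  moreover have f_in: "f p \<in> U \<times> sphere 0 1" and gf: "g (f p) = p" if "p \<in> \<Omega>" for p
  proof -
    obtain z t where p: "p = (z, t)" by fastforce
    have "w (z, t) \<in> U" "z \<noteq> 0" using that nz p assms(3) by auto
    \<comment> \<open>The modulus lost in z/|z| is recovered as the square root of Im w =
      |z|^2.\<close>
    then show "f p \<in> U \<times> sphere 0 1" "g (f p) = p"
      by (auto simp: p f_eq g_eq w_parts)
  qed
  moreover have g_in: "g q \<in> \<Omega>" and fg: "f (g q) = q" if "q \<in> U \<times> sphere 0 1" for q
  proof -
    from that obtain u s where q: "q = (u, s)" "u \<in> U" "cmod s = 1" by auto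
    \<comment> \<open>As |s| = 1, the first coordinate has squared modulus Im u.\<close>
    have w_u: "w (sqrt (Im u) *\<^sub>R s, Re u) = u"
      using Im_pos[OF q(2)] q(3) by (intro complex_eqI) (simp_all add: w_parts)
    with q show "g q \<in> \<Omega>"
      by (simp add: g_eq assms(3))
    \<comment> \<open>Normalising sqrt(Im u) s returns s, since its modulus sqrt(Im u) is
      positive.\<close>
    show "f (g q) = q"
      using Im_pos[OF q(2)] q(3) by (simp add: q(1) g_eq[OF q(2)] f_eq w_u)
  qed
  moreover have "f ` \<Omega> = U \<times> sphere 0 1"
    by (rule bij_betw_imp_surj_on[OF bij_betw_byWitness[where f' = g]])
      (use f_in g_in fg gf in \<open>blast+\<close>)
  moreover have "g ` (U \<times> sphere 0 1) = \<Omega>"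
    by (rule bij_betw_imp_surj_on[OF bij_betw_byWitness[where f' = f]])
      (use f_in g_in fg gf in \<open>blast+\<close>)
  ultimately show ?thesis
    unfolding diffeomorphic_def by (intro exI[of _ f] exI[of _ g]) simp
qed

end
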